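(* Let $v_{\infty1}>v_{\infty2}>0$ and $n_1>n_2>1$. Any isolated coincidence point on the boundary of the phase space $\mathcal D$ is a quasi-umbilic point.
   Context: Phase space: $\mathcal D=\{\Phi=(\phi_1,\phi_2)^{\mathrm T}\in\mathbb R^2:\phi_1\ge0,\ \phi_2\ge0,\ \phi:=\phi_1+\phi_2\le 1\}$ (maximum packing concentration equal to $1$). On $\mathcal D$ set $u_i(\Phi)=v_{\infty i}(1-\phi)^{n_i-1}$, $v_i(\Phi)=u_i(\Phi)-\phi_1u_1(\Phi)-\phi_2u_2(\Phi)$, $f_i(\Phi)=\phi_iv_i(\Phi)$ for $i=1,2$, and let $\boldsymbol J(\Phi)$ be the Jacobian matrix of $\boldsymbol f=(f_1,f_2)^{\mathrm T}$ (on the boundary of $\mathcal D$, that of the defining formula). A point $\Phi\in\mathcal D$ is a coincidence point if the two eigenvalues of $\boldsymbol J(\Phi)$ coincide. The eigenvalues are given by $\tfrac12(v_1+v_2)-\tfrac12(n_1\phi_1u_1+n_2\phi_2u_2)\pm\tfrac12\sqrt{\Delta_\Phi}$, with $\Delta_\Phi=[(n_1\phi_1-1)u_1-(n_2\phi_2-1)u_2]^2+4n_1n_2\phi_1\phi_2u_1u_2$, and at states with $\phi=1$ they are understood through this formula (so both vanish there). A coincidence point $\Phi^*$ is isolated if there is a neighborhood $V$ of $\Phi^*$ in $\mathcal D$ such that the eigenvalues are distinct for all $\Phi\in V\setminus\{\Phi^*\}$. A quasi-umbilic point is an isolated coincidence point $\Phi^*$ at which $\boldsymbol J(\Phi^*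 )$ is not diagonalizable. *)

theory Defs
  imports "HOL-Analysis.Analysis" "Jordan_Normal_Form.Char_Poly"
begin

definition diagonalizable_mat :: "'a::semiring_1 mat \<Rightarrow> bool" where
  "diagonalizable_mat A \<longleftrightarrow> (\<exists>B. diagonal_mat B \<and> similar_mat A B)"

definition phase_space :: "(real \<times> real) set" where
  "phase_space = {(x, y). x \<ge> 0 \<and> y \<ge> 0 \<and> x + y \<le> 1}"

locale bidisperse_model =
  fixes vinf1 vinf2 n1 n2 :: real
begin

definition u1 :: "real \<times> real \<Rightarrow> real" where
  "u1 = (\<lambda>(x, y). vinf1 * (1 - (x + y)) powr (n1 - 1))"

definition u2 :: "real \<times> real \<Rightarrow> real" where
  "u2 = (\<lambda>(x, y). vinf2 * (1 - (x + y)) powr (n2 - 1))"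

definition v1 :: "real \<times> real \<Rightarrow> real" where
  "v1 = (\<lambda>(x, y). u1 (x, y) - x * u1 (x, y) - y * u2 (x, y))"

definition v2 :: "real \<times> real \<Rightarrow> real" where
  "v2 = (\<lambda>(x, y). u2 (x, y) - x * u1 (x, y) - y * u2 (x, y))"

definition f1 :: "real \<times> real \<Rightarrow> real" where
  "f1 = (\<lambda>(x, y). x * v1 (x, y))"

definition f2 :: "real \<times> real \<Rightarrow> real" where
  "f2 = (\<lambda>(x, y). y * v2 (x, y))"

text \<open>The partial derivatives are those of the defining formulas, which are smooth on the
  open half-plane \<open>x + y < 1\<close> and hence also at the points of the phase space with
  \<open>x = 0\<close> or \<open>y = 0\<close>. At a point with \<open>x + y = 1\<close> they need not exist, and then
  the corresponding entry is arbitrary.\<close>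

definition J :: "real \<times> real \<Rightarrow> real mat" where
  "J = (\<lambda>(x, y). mat_of_rows_list 2
     [[deriv (\<lambda>s. f1 (s, y)) x, deriv (\<lambda>t. f1 (x, t)) y],
      [deriv (\<lambda>s. f2 (s, y)) x, deriv (\<lambda>t. f2 (x, t)) y]])"

definition discr :: "real \<times> real \<Rightarrow> real" where
  "discr = (\<lambda>(x, y). ((n1 * x - 1) * u1 (x, y) - (n2 * y - 1) * u2 (x, y))\<^sup>2
                     + 4 * n1 * n2 * x * y * u1 (x, y) * u2 (x, y))"

definition eig_plus :: "real \<times> real \<Rightarrow> real" where
  "eig_plus = (\<lambda>(x, y). (v1 (x, y) + v2 (x, y)) / 2
     - (n1 * x * u1 (x, y) + n2 * y * u2 (x, y)) / 2 + sqrt (discr (x, y)) / 2)"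

definition eig_minus :: "real \<times> real \<Rightarrow> real" where
  "eig_minus = (\<lambda>(x, y). (v1 (x, y) + v2 (x, y)) / 2
     - (n1 * x * u1 (x, y) + n2 * y * u2 (x, y)) / 2 - sqrt (discr (x, y)) / 2)"

text \<open>The two eigenvalues, counted with algebraic multiplicity and in either order, are
  \<open>a\<close> and \<open>b\<close>. Where \<open>x + y < 1\<close> this refers to the Jacobian matrix itself; at
  \<open>x + y = 1\<close> the closed form of the eigenvalues is used instead.\<close>

definition has_eigenvalues :: "real \<times> real \<Rightarrow> real \<Rightarrow> real \<Rightarrow> bool" where
  "has_eigenvalues \<Phi> a b \<longleftrightarrow>
     (if fst \<Phi> + snd \<Phi> < 1 then char_poly (J \<Phi>) = [:- a, 1:] * [:- b, 1:]
      else {#a, b#} = {#eig_plus \<Phi>, eig_minus \<Phi>#})"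

definition coincidence_point :: "real \<times> real \<Rightarrow> bool" where
  "coincidence_point \<Phi> \<longleftrightarrow> \<Phi> \<in> phase_space \<and> (\<exists>\<mu>. has_eigenvalues \<Phi> \<mu> \<mu>)"

definition isolated_coincidence_point :: "real \<times> real \<Rightarrow> bool" where
  "isolated_coincidence_point \<Phi>0 \<longleftrightarrow> coincidence_point \<Phi>0 \<and>
     (\<exists>V. openin (top_of_set phase_space) V \<and> \<Phi>0 \<in> V \<and>
          (\<forall>\<Phi> \<in> V - {\<Phi>0}. \<exists>a b. has_eigenvalues \<Phi> a b \<and> a \<noteq> b))"

definition quasi_umbilic_point :: "real \<times> real \<Rightarrow> bool" where
  "quasi_umbilic_point \<Phi> \<longleftrightarrow> isolated_coincidence_point \<Phi> \<and> \<not> diagonalizable_mat (J \<Phi>)"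

end

end

theory Submission
  imports Defs
begin

text \<open>On the edge \<open>\<phi> = 1\<close> both velocities \<open>u\<^sub>i\<close> vanish, so every point of that edge is a
  coincidence point and none is isolated. On the rest of the boundary \<open>\<phi>\<^sub>1 = 0\<close> or
  \<open>\<phi>\<^sub>2 = 0\<close>. A diagonalizable matrix with a double eigenvalue is scalar, whereas on
  \<open>\<phi>\<^sub>1 = 0\<close> the entry \<open>\<partial>f\<^sub>2 / \<partial>\<phi>\<^sub>1 = - \<phi>\<^sub>2 ((n\<^sub>2 - 1) u\<^sub>2 + u\<^sub>1)\<close> is nonzero unless
  \<open>\<phi>\<^sub>2 = 0\<close>, and symmetrically on \<open>\<phi>\<^sub>2 = 0\<close>. At the origin the eigenvalues are
  \<open>v\<^sub>\<infinity>\<^sub>1 \<noteq> v\<^sub>\<infinity>\<^sub>2\<close>.\<close>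

text \<open>The diagonal entries of a diagonal matrix similar to \<open>A\<close> are roots of
  \<open>char_poly A\<close>, so all equal \<open>c\<close>. Conjugation does not move the scalar
  matrix obtained this way.\<close>

lemma diagonalizable_mat_single_eigenvalue:
  fixes A :: "'a::field mat"
  assumes A: "A \<in> carrier_mat n n"
    and diag: "diagonalizable_mat A"
    and cp: "char_poly A = [:- c, 1:] ^ k"
  shows "A = c \<cdot>\<^sub>m 1\<^sub>m n"
proof -
  obtain B where B: "diagonal_mat B" "similar_mat A B"
    using diag by (auto simp: diagonalizable_mat_def)
  from B(2) obtain P Q where PQ: "similar_mat_wit A B P Q"
    by (auto simp: similar_mat_def)
  note w = similar_mat_witD2[OF A PQ]
  have cB: "B \<in> carrier_mat n n" using w by blast
  have "upper_triangular B"
    using B(1) cB by (auto simp: diagonal_mat_def upper_triangular_def)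
  then have cpB: "[:- c, 1:] ^ k = (\<Prod>a\<leftarrow>diag_mat B. [:- a, 1:])"
    using char_poly_upper_triangular[OF cB] char_poly_similar[OF B(2)] cp by simp
  have entry: "B $$ (i, i) = c" if i: "i < n" for i
  proof -
    have "B $$ (i, i) \<in> set (diag_mat B)"
      using i cB by (auto simp: diag_mat_def)
    then have "poly (\<Prod>a\<leftarrow>diag_mat B. [:- a, 1:]) (B $$ (i, i)) = 0"
      by (force simp: poly_prod_list prod_list_zero_iff)
    then have "poly ([:- c, 1:] ^ k) (B $$ (i, i)) = 0"
      using cpB by simp
    then show ?thesis
      by (simp add: poly_power)
  qed
  have "B = c \<cdot>\<^sub>m 1\<^sub>m n"
    using B(1) cB entry by (intro eq_matI) (auto simp: diagonal_mat_def)
  moreover have "P * (c \<cdot>\<^sub>m 1\<^sub>m n) * Q = c \<cdot>\<^sub>m (P * Q)"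
    using w by (simp add: mult_smult_distrib[of _ n n _ n] mult_smult_assoc_mat[of _ n n _ n])
  ultimately show ?thesis
    using w by simp
qed

text \<open>The three strict inequalities cut out an open subset of \<open>phase_space\<close>, so a
  point satisfying all of them is interior.\<close>

lemma frontier_phase_space_cases:
  assumes "(x, y) \<in> frontier phase_space" "(x, y) \<in> phase_space"
  shows "x + y = 1 \<or> x = 0 \<or> y = 0"
proof (rule ccontr)
  assume *: "\<not> ?thesis"
  let ?U = "{p::real \<times> real. 0 < fst p \<and> 0 < snd p \<and> fst p + snd p < 1}"
  have "open ?U"
    by (intro open_Collect_conj open_Collect_less continuous_intros)
  moreover have "?U \<subseteq> phase_space"
    by (auto simp: phase_space_def)
  moreover have "(x, y) \<in> ?U"
    using * assms(2) by (auto simp: phase_space_def)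
  ultimately have "(x, y) \<in> interior phase_space"
    by (meson interior_maximal subsetD)
  then show False
    using assms(1) by (simp add: frontier_def)
qed

lemma phase_space_edge_accumulation:
  assumes "x + y = 1" "(x, y) \<in> phase_space"
    and "openin (top_of_set phase_space) V" "(x, y) \<in> V"
  obtains x' y' where "(x', y') \<in> V" "(x', y') \<noteq> (x, y)" "x' + y' = 1"
proof -
  obtain T where T: "open T" "V = phase_space \<inter> T"
    using assms(3) by (auto simp: openin_open)
  \<comment> \<open>This parametrizes the edge by the unit interval, which is connected with more
    than one point and so has no isolated points.\<close>
  let ?g = "\<lambda>t. (t, 1 - t) :: real \<times> real"
  have y: "y = 1 - x" and x: "x \<in> {0..1}"
    using assms by (auto simp: phase_space_def)
  have "open (?g -` T)"
    using T(1) by (intro open_vimage continuous_intros)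
  moreover have "x \<in> ?g -` T"
    using assms(4) T(2) y by simp
  moreover have "x islimpt {0..1}"
    using x by (intro connected_imp_perfect) auto
  ultimately obtain t where "t \<in> {0..1}" "t \<in> ?g -` T" "t \<noteq> x"
    by (auto simp: islimpt_def)
  then show thesis
    using T(2) by (intro that[of t "1 - t"]) (auto simp: phase_space_def)
qed

text \<open>One formula for both edges: \<open>s\<close> is the concentration that vanishes there
  and \<open>y\<close> the other one. Exchanging the two species turns one edge into the
  other.\<close>

lemma cross_flux_derivative:
  fixes a b m n y :: real
  assumes "y < 1"
  shows "((\<lambda>s. y * (b * (1 - (s + y)) powr (n - 1) - s * (a * (1 - (s + y)) powr (m - 1))
            - y * (b * (1 - (s + y)) powr (n - 1)))) has_real_derivative
          - y * ((n - 1) * (b * (1 - y) powr (n - 1)) + a * (1 - y) powr (m - 1))) (at 0)"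
proof -
  \<comment> \<open>Differentiation lowers the exponent to \<open>n - 2\<close>; the factor
    \<open>1 - y\<close> left by the two terms in \<open>b\<close> raises it again.\<close>
  have expand: "(1 - y) powr (n - 1) = (1 - y) powr (n - 2) - y * (1 - y) powr (n - 2)"
    using assms powr_mult_base[of "1 - y" "n - 2"] by (simp add: left_diff_distrib)
  show ?thesis
    using assms
    by (auto intro!: derivative_eq_intros simp: expand algebra_simps)
qed

context bidisperse_model
begin

lemma J_carrier: "J \<Phi> \<in> carrier_mat 2 2"
  by (cases \<Phi>) (auto simp: J_def mat_of_rows_list_def)

lemma J_entries:
  "J (x, y) $$ (0, 0) = deriv (\<lambda>s. f1 (s, y)) x"
  "J (x, y) $$ (0, 1) = deriv (\<lambda>t. f1 (x, t)) y"
  "J (x, y) $$ (1, 0) = deriv (\<lambda>s. f2 (s, y)) x"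
  "J (x, y) $$ (1, 1) = deriv (\<lambda>t. f2 (x, t)) y"
  by (auto simp: J_def mat_of_rows_list_def)

lemma J_lower_left_edge:
  assumes "y < 1"
  shows "J (0, y) $$ (1, 0) = - y * ((n2 - 1) * u2 (0, y) + u1 (0, y))"
  unfolding J_entries
  by (rule DERIV_imp_deriv)
    (use cross_flux_derivative[OF assms, of vinf2 n2 vinf1 n1]
      in \<open>simp add: f2_def v2_def u1_def u2_def\<close>)

lemma J_upper_right_edge:
  assumes "x < 1"
  shows "J (x, 0) $$ (0, 1) = - x * ((n1 - 1) * u1 (x, 0) + u2 (x, 0))"
proof -
  \<comment> \<open>The flux of species 1 is brought into the shape of
    \<open>cross_flux_derivative\<close>, with the vanishing concentration first.\<close>
  have "(\<lambda>t. f1 (x, t)) = (\<lambda>t. x * (vinf1 * (1 - (t + x)) powr (n1 - 1)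
      - t * (vinf2 * (1 - (t + x)) powr (n2 - 1)) - x * (vinf1 * (1 - (t + x)) powr (n1 - 1))))"
    by (rule ext) (simp add: f1_def v1_def u1_def u2_def algebra_simps)
  then show ?thesis
    unfolding J_entries
    using DERIV_imp_deriv[OF cross_flux_derivative[OF assms, of vinf1 n1 vinf2 n2]]
    by (simp add: u1_def u2_def)
qed

text \<open>These three entries make the matrix upper triangular and fix its diagonal, which
  determines the eigenvalues.\<close>

lemma J_origin:
  "J (0, 0) $$ (0, 0) = vinf1" "J (0, 0) $$ (1, 1) = vinf2" "J (0, 0) $$ (1, 0) = 0"
proof -
  have "((\<lambda>s. f1 (s, 0)) has_real_derivative vinf1) (at 0)"
    "((\<lambda>t. f2 (0, t)) has_real_derivative vinf2) (at 0)"
    by (auto intro!: derivative_eq_intros simp: f1_def v1_def f2_def v2_def u1_def u2_def)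
  then show "J (0, 0) $$ (0, 0) = vinf1" "J (0, 0) $$ (1, 1) = vinf2"
    unfolding J_entries by (auto intro: DERIV_imp_deriv)
  show "J (0, 0) $$ (1, 0) = 0"
    using J_lower_left_edge[of 0] by simp
qed

lemma char_poly_J_origin: "char_poly (J (0, 0)) = [:- vinf1, 1:] * [:- vinf2, 1:]"
proof -
  have "upper_triangular (J (0, 0))"
    using J_carrier[of "(0, 0)"] J_origin(3)
    by (auto simp: upper_triangular_def less_2_cases_iff)
  moreover have "diag_mat (J (0, 0)) = [vinf1, vinf2]"
    using J_carrier[of "(0, 0)"] J_origin by (simp add: diag_mat_def numeral_2_eq_2)
  ultimately show ?thesis
    using char_poly_upper_triangular[OF J_carrier[of "(0, 0)"]] by simp
qed

lemma eigenvalues_coincide_at_max_concentration: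
  assumes "x + y = 1" "has_eigenvalues (x, y) a b"
  shows "a = b"
proof -
  \<comment> \<open>\<open>0 powr a\<close> is 0 for every real \<open>a\<close>, so both velocities
    vanish whatever the exponents are.\<close>
  have "u1 (x, y) = 0" "u2 (x, y) = 0"
    using assms(1) by (auto simp: u1_def u2_def)
  then have "eig_plus (x, y) = eig_minus (x, y)"
    by (simp add: eig_plus_def eig_minus_def discr_def)
  then show ?thesis
    using assms by (auto simp: has_eigenvalues_def add_eq_conv_diff)
qed

lemma isolated_coincidence_point_max_concentration:
  assumes "isolated_coincidence_point (x, y)"
  shows "x + y < 1"
proof (rule ccontr)
  obtain V where V: "openin (top_of_set phase_space) V" "(x, y) \<in> V"
      "\<forall>\<Psi>\<in>V - {(x, y)}. \<exists>a b. has_eigenvalues \<Psi> a b \<and> a \<noteq> b"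
    and ps: "(x, y) \<in> phase_space"
    using assms by (auto simp: isolated_coincidence_point_def coincidence_point_def)
  assume "\<not> x + y < 1"
  then have "x + y = 1"
    using ps by (auto simp: phase_space_def)
  then obtain x' y' where "(x', y') \<in> V" "(x', y') \<noteq> (x, y)" "x' + y' = 1"
    using phase_space_edge_accumulation ps V by metis
  then show False
    using V(3) eigenvalues_coincide_at_max_concentration by blast
qed

end

theorem corollary1:
  fixes vinf1 vinf2 n1 n2 :: real and \<Phi> :: "real \<times> real"
  assumes "vinf1 > vinf2" and "vinf2 > 0"
    and "n1 > n2" and "n2 > 1"
    and "bidisperse_model.isolated_coincidence_point vinf1 vinf2 n1 n2 \<Phi>"
    and "\<Phi> \<in> frontier phase_space"
  shows "bidisperse_model.quasi_umbilic_point vinf1 vinf2 n1 n2 \<Phi>"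
proof -
  interpret bidisperse_model vinf1 vinf2 n1 n2 .
  obtain x y where \<Phi>: "\<Phi> = (x, y)" by (cases \<Phi>)
  have iso: "isolated_coincidence_point (x, y)"
    using assms(5) \<Phi> by simp
  have lt: "x + y < 1"
    using isolated_coincidence_point_max_concentration[OF iso] .
  have ps: "(x, y) \<in> phase_space"
    using iso by (auto simp: isolated_coincidence_point_def coincidence_point_def)
  have edge: "x = 0 \<or> y = 0"
    using frontier_phase_space_cases[of x y] assms(6) \<Phi> ps lt by auto
  \<comment> \<open>Below maximum concentration \<open>has_eigenvalues\<close> speaks of the
    characteristic polynomial itself, so coincidence makes it a square.\<close>
  obtain \<mu> where cp: "char_poly (J (x, y)) = [:- \<mu>, 1:] ^ 2"
    using iso lt
    by (auto simp: isolated_coincidence_point_def coincidence_point_def has_eigenvalues_def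
        power2_eq_square)
  have "(x, y) \<noteq> (0, 0)"
  proof
    assume "(x, y) = (0, 0)"
    then have eq: "[:- \<mu>, 1:] ^ 2 = [:- vinf1, 1:] * [:- vinf2, 1:]"
      using cp char_poly_J_origin by simp
    \<comment> \<open>Evaluated at either velocity, the right-hand side of \<open>eq\<close>
      vanishes, hence so does the square.\<close>
    have "vinf1 = \<mu>" "vinf2 = \<mu>"
      using arg_cong[OF eq, of "\<lambda>p. poly p vinf1"] arg_cong[OF eq, of "\<lambda>p. poly p vinf2"]
      by auto
    then show False using assms(1) by simp
  qed
  have pos: "u1 (x, y) > 0" "u2 (x, y) > 0"
    using assms(1,2) lt by (auto simp: u1_def u2_def)
  \<comment> \<open>Away from the origin the surviving concentration is nonzero, and the bracket
    multiplying it is a sum of positive terms because both exponents exceed 1.\<close>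
  have off_diagonal: "J (x, y) $$ (1, 0) \<noteq> 0 \<or> J (x, y) $$ (0, 1) \<noteq> 0"
  proof (cases "x = 0")
    case True
    then have "y \<noteq> 0" "(n2 - 1) * u2 (x, y) + u1 (x, y) > 0"
      using \<open>(x, y) \<noteq> (0, 0)\<close> pos assms(4) by (auto intro: add_pos_pos)
    then show ?thesis
      using True lt J_lower_left_edge[of y] by auto
  next
    case False
    then have "y = 0" "(n1 - 1) * u1 (x, y) + u2 (x, y) > 0"
      using edge pos assms(3,4) by (auto intro: add_pos_pos)
    then show ?thesis
      using False lt J_upper_right_edge[of x] by auto
  qed
  have "\<not> diagonalizable_mat (J (x, y))"
  proof
    assume "diagonalizable_mat (J (x, y))"
    then have "J (x, y) = \<mu> \<cdot>\<^sub>m 1\<^sub>m 2"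
      using diagonalizable_mat_single_eigenvalue[OF J_carrier _ cp] by blast
    then show False
      using off_diagonal by simp
  qed
  then show ?thesis
    using iso \<Phi> by (simp add: quasi_umbilic_point_def)
qed

end
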